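(* Let $n\ge 2$ and let $p(x)=x^n+a_{n-1}x^{n-1}+\dots+a_1x+a_0$ be a monic polynomial with real coefficients and $a_0\neq 0$. Let $C_1$ be the companion matrix of $p$ and $C_2$ the companion matrix of the monic reversal polynomial $q$ of $p$. Let $N_1$ and $N_2$ be (submultiplicative) matrix norms on the $n\times n$ complex matrices, and let $k_1,k_2$ be positive integers. Then every (complex) root of $p$ is contained in the annulus $$\Omega_{k_1,k_2}=\left\{x+iy \;:\; x,y\in\mathbb{R},\ \frac{1}{\sqrt[k_2]{N_2\left(C_2^{k_2}\right)}}\le \sqrt{x^2+y^2}\le \sqrt[k_1]{N_1\left(C_1^{k_1}\right)}\right\}.$$
   Context: A matrix norm is a norm $N$ on the space of $n\times n$ complex matrices which is submultiplicative: $N(AB)\le N(A)N(B)$. For a monic polynomial $f(x)=x^n+c_{n-1}x^{n-1}+\dots+c_0$, the companion matrix of $f$ is the $n\times n$ matrix with $1$'s on the first subdiagonal, last column $(-c_0,-c_1,\dots,-c_{n-1})^{T}$, and all other entries $0$. For $p(x)=x^n+a_{n-1}x^{n-1}+\dots+a_0$ with $a_0\ne0$, the monic reversal polynomial of $p$ is $q(x)=x^n+\frac{a_1}{a_0}x^{n-1}+\dots+\frac{a_{n-1}}{a_0}x+\frac{1}{a_0}$. *)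

theory Defs
  imports Complex_Main "HOL-Computational_Algebra.Polynomial" "Jordan_Normal_Form.Matrix"
begin

definition submult_matrix_norm :: "nat \<Rightarrow> (complex mat \<Rightarrow> real) \<Rightarrow> bool" where
  "submult_matrix_norm n N \<longleftrightarrow>
     (\<forall>A \<in> carrier_mat n n. 0 \<le> N A) \<and>
     (\<forall>A \<in> carrier_mat n n. N A = 0 \<longleftrightarrow> A = 0\<^sub>m n n) \<and>
     (\<forall>c. \<forall>A \<in> carrier_mat n n. N (c \<cdot>\<^sub>m A) = cmod c * N A) \<and>
     (\<forall>A \<in> carrier_mat n n. \<forall>B \<in> carrier_mat n n. N (A + B) \<le> N A + N B) \<and>
     (\<forall>A \<in> carrier_mat n n. \<forall>B \<in> carrier_mat n n. N (A * B) \<le> N A * N B)"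

text \<open>Intended for monic \<open>f\<close>; rows and columns are indexed from 0.\<close>

definition companion_mat :: "'a :: ring_1 poly \<Rightarrow> 'a mat" where
  "companion_mat f = mat (degree f) (degree f)
     (\<lambda>(i, j). if j = degree f - 1 then - coeff f i else if i = j + 1 then 1 else 0)"

definition monic_reversal :: "'a :: field poly \<Rightarrow> 'a poly" where
  "monic_reversal p = Polynomial.smult (1 / coeff p 0) (reflect_poly p)"

lemma monic_reversal_explicit:
  fixes p :: "'a :: field poly"
  assumes "lead_coeff p = 1" "coeff p 0 \<noteq> 0" "degree p = n" "n \<ge> 1"
  shows "monic_reversal p =
    monom 1 n + (\<Sum>i = 1..<n. monom (coeff p (n - i) / coeff p 0) i) + [:1 / coeff p 0:]"
proof (rule poly_eqI)
  fix m
  have "coeff (\<Sum>i = 1..<n. monom (coeff p (n - i) / coeff p 0) i) m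
      = (if m \<in> {1..<n} then coeff p (n - m) / coeff p 0 else 0)"
    by (simp add: coeff_sum)
  then show "coeff (monic_reversal p) m = coeff (monom 1 n +
      (\<Sum>i = 1..<n. monom (coeff p (n - i) / coeff p 0) i) + [:1 / coeff p 0:]) m"
    using assms by (auto simp: monic_reversal_def coeff_reflect_poly coeff_pCons split: nat.split)
qed

definition annulus ::
  "(complex mat \<Rightarrow> real) \<Rightarrow> (complex mat \<Rightarrow> real) \<Rightarrow> complex mat \<Rightarrow> complex mat \<Rightarrow> nat \<Rightarrow> nat \<Rightarrow> complex set"
  where
  "annulus N\<^sub>1 N\<^sub>2 C\<^sub>1 C\<^sub>2 k\<^sub>1 k\<^sub>2 =
     {Complex x y | x y.
        1 / root k\<^sub>2 (N\<^sub>2 (C\<^sub>2 ^\<^sub>m k\<^sub>2)) \<le> sqrt (x\<^sup>2 + y\<^sup>2) \<and>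
        sqrt (x\<^sup>2 + y\<^sup>2) \<le> root k\<^sub>1 (N\<^sub>1 (C\<^sub>1 ^\<^sub>m k\<^sub>1))}"

end

theory Submission
  imports Defs
begin

text \<open>
  If \<open>z\<close> is a root of \<open>f\<close>, then \<open>(1, z, \<dots>, z\<^bsup>n-1\<^esup>)\<close> is a left eigenvector of the companion
  matrix \<open>C\<close> with eigenvalue \<open>z\<close>. The matrix \<open>V\<close> all of whose rows are this vector thus
  satisfies \<open>V C\<^sup>k = z\<^sup>k V\<close>, and any submultiplicative norm gives \<open>\<bar>z\<bar>\<^sup>k \<le> N (C\<^sup>k)\<close>. The lower
  bound is this estimate for the root \<open>1/z\<close> of the reversal.
\<close>

lemma companion_mat_carrier:
  "companion_mat f \<in> carrier_mat (degree f) (degree f)"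
  by (simp add: companion_mat_def)

text \<open>Every column but the last is a unit vector that picks out the next power of
  \<open>z\<close>. The last column produces minus the lower-order part of \<open>f\<close> at
  \<open>z\<close>, which is \<open>z ^ degree f\<close> because \<open>f\<close> is monic and
  vanishes there. The row is repeated to a square matrix so that a norm on square matrices applies
  to it.\<close>

lemma vandermonde_rows_mult_companion_mat:
  fixes f :: "'a :: comm_ring_1 poly"
  assumes monic: "lead_coeff f = 1" and root: "poly f z = 0"
  defines "V \<equiv> mat (degree f) (degree f) (\<lambda>(i, j). z ^ j)"
  shows "V * companion_mat f = z \<cdot>\<^sub>m V"
proof (rule eq_matI)
  let ?n = "degree f"
  fix i j assume "i < dim_row (z \<cdot>\<^sub>m V)" and "j < dim_col (z \<cdot>\<^sub>m V)"
  then have i: "i < ?n" and j: "j < ?n" by (simp_all add: V_def)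
  have entry: "(V * companion_mat f) $$ (i, j) = (\<Sum>l<?n. z ^ l *
      (if j = ?n - 1 then - coeff f l else if l = j + 1 then 1 else 0))"
    using i j by (simp add: V_def companion_mat_def scalar_prod_def atLeast0LessThan)
  have "(\<Sum>l<?n. z ^ l * (if j = ?n - 1 then - coeff f l else if l = j + 1 then 1 else 0))
      = z ^ Suc j"
  proof (cases "j = ?n - 1")
    case True
    have "(\<Sum>l<?n. coeff f l * z ^ l) + z ^ ?n = 0"
      using root monic by (simp add: poly_altdef flip: lessThan_Suc_atMost)
    then show ?thesis
      using True j by (simp add: sum_negf mult.commute add_eq_0_iff)
  next
    case False
    \<comment> \<open>The row index of the single 1 in column \<open>j\<close> must lie within the
      range of summation.\<close>
    then have "Suc j < ?n" using j by simp
    then show ?thesis using False by (simp add: if_distrib[of "(*) _"] sum.delta cong: if_cong)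
  qed
  then show "(V * companion_mat f) $$ (i, j) = (z \<cdot>\<^sub>m V) $$ (i, j)"
    using entry i j by (simp add: V_def)
qed (simp_all add: V_def companion_mat_def)

lemma mult_pow_mat_eigen:
  fixes V C :: "'a :: comm_semiring_1 mat"
  assumes V: "V \<in> carrier_mat m n" and C: "C \<in> carrier_mat n n" and eig: "V * C = z \<cdot>\<^sub>m V"
  shows "V * C ^\<^sub>m k = z ^ k \<cdot>\<^sub>m V"
proof (induction k)
  case 0
  show ?case using V C by (auto intro!: eq_matI)
next
  case (Suc k)
  have "V * C ^\<^sub>m Suc k = V * C ^\<^sub>m k * C"
    using assoc_mult_mat[OF V pow_carrier_mat[OF C] C] by simp
  also have "\<dots> = z ^ k \<cdot>\<^sub>m (V * C)"
    using mult_smult_assoc_mat[OF V C] Suc by simp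
  also have "\<dots> = z ^ Suc k \<cdot>\<^sub>m V"
    unfolding eig by (intro eq_matI) (simp_all add: ac_simps)
  finally show ?case .
qed

lemma root_power_le_norm_companion_mat_power:
  fixes f :: "complex poly"
  assumes N: "submult_matrix_norm (degree f) N" and deg: "degree f > 0"
    and monic: "lead_coeff f = 1" and root: "poly f z = 0"
  shows "cmod z ^ k \<le> N (companion_mat f ^\<^sub>m k)"
proof -
  let ?n = "degree f"
  define V where "V = mat ?n ?n (\<lambda>(i, j). z ^ j)"
  have V: "V \<in> carrier_mat ?n ?n" by (simp add: V_def)
  \<comment> \<open>This entry is \<open>z ^ 0 = 1\<close>, even for \<open>z = 0\<close>; the
    resulting \<open>N V > 0\<close> lets the factor \<open>N V\<close> be cancelled at the
    end.\<close>
  have "V $$ (0, 0) \<noteq> 0\<^sub>m ?n ?n $$ (0, 0)" using deg by (simp add: V_def)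
  then have "V \<noteq> 0\<^sub>m ?n ?n" by metis
  then have pos: "N V > 0" using N V unfolding submult_matrix_norm_def by force
  have "cmod z ^ k * N V = N (z ^ k \<cdot>\<^sub>m V)"
    using N V by (simp add: submult_matrix_norm_def norm_power)
  also have "\<dots> = N (V * companion_mat f ^\<^sub>m k)"
    using mult_pow_mat_eigen[OF V companion_mat_carrier
        vandermonde_rows_mult_companion_mat[OF monic root, folded V_def]] by simp
  also have "\<dots> \<le> N V * N (companion_mat f ^\<^sub>m k)"
    using N V pow_carrier_mat[OF companion_mat_carrier] unfolding submult_matrix_norm_def by blast
  finally show ?thesis using pos by (simp add: mult.commute)
qed

text \<open>Both radii of the annulus come from this form: \<open>f = p\<close> gives the outer one,
  the reversal of \<open>p\<close> the inner one. Embedding the reals commutes with forming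
  companion matrices, and \<open>root k\<close> is monotone and undoes the \<open>k\<close>-th power
  of \<open>cmod z\<close>.\<close>

lemma root_norm_le_root_norm_companion_mat_power:
  fixes f :: "real poly"
  assumes N: "submult_matrix_norm (degree f) N" and deg: "degree f > 0"
    and monic: "lead_coeff f = 1" and root: "poly (map_poly complex_of_real f) z = 0"
    and k: "k > 0"
  shows "cmod z \<le> root k (N (map_mat complex_of_real (companion_mat f) ^\<^sub>m k))"
proof -
  let ?f = "map_poly complex_of_real f"
  have d: "degree ?f = degree f" by (simp add: degree_map_poly)
  have "companion_mat ?f = map_mat complex_of_real (companion_mat f)"
    by (rule eq_matI) (auto simp: companion_mat_def d coeff_map_poly)
  moreover have "cmod z ^ k \<le> N (companion_mat ?f ^\<^sub>m k)"
    by (rule root_power_le_norm_companion_mat_power)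
      (use N deg monic root d in \<open>simp_all add: coeff_map_poly\<close>)
  ultimately show ?thesis
    using k real_root_le_mono[OF k] by (metis norm_ge_zero real_root_power_cancel)
qed

text \<open>A nonzero constant coefficient keeps the degree under reflection and becomes the leading
  coefficient, which the scaling turns into 1. Hence both companion matrices have the same
  size.\<close>

lemma
  assumes "coeff p 0 \<noteq> 0"
  shows degree_monic_reversal: "degree (monic_reversal p) = degree p"
    and lead_coeff_monic_reversal: "lead_coeff (monic_reversal p) = 1"
  using assms by (simp_all add: monic_reversal_def coeff_reflect_poly)

lemma map_poly_of_real_monic_reversal:
  "map_poly complex_of_real (monic_reversal p) = monic_reversal (map_poly complex_of_real p)"
  by (rule poly_eqI)
    (simp add: monic_reversal_def coeff_map_poly coeff_reflect_poly degree_map_poly)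

text \<open>At \<open>inverse z\<close> the reflected polynomial takes the value
  \<open>inverse z ^ degree p * poly p z\<close>.\<close>

lemma poly_monic_reversal_inverse:
  assumes "poly p z = 0" and "z \<noteq> 0"
  shows "poly (monic_reversal p) (inverse z) = 0"
  using assms by (simp add: monic_reversal_def poly_reflect_poly_nz)

theorem theorem2p2:
  fixes p :: "real poly" and n k\<^sub>1 k\<^sub>2 :: nat
    and N\<^sub>1 N\<^sub>2 :: "complex mat \<Rightarrow> real" and C\<^sub>1 C\<^sub>2 :: "complex mat"
  assumes "n \<ge> 2"
    and "degree p = n" and "lead_coeff p = 1" and "coeff p 0 \<noteq> 0"
    and "C\<^sub>1 = map_mat complex_of_real (companion_mat p)"
    and "C\<^sub>2 = map_mat complex_of_real (companion_mat (monic_reversal p))"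
    and "submult_matrix_norm n N\<^sub>1" and "submult_matrix_norm n N\<^sub>2"
    and "k\<^sub>1 > 0" and "k\<^sub>2 > 0"
  shows "\<forall>z :: complex. poly (map_poly complex_of_real p) z = 0 \<longrightarrow>
           z \<in> annulus N\<^sub>1 N\<^sub>2 C\<^sub>1 C\<^sub>2 k\<^sub>1 k\<^sub>2"
proof (intro allI impI)
  fix z assume z: "poly (map_poly complex_of_real p) z = 0"
  have "z \<noteq> 0"
    using z assms(4) by (auto simp: poly_0_coeff_0 coeff_map_poly)
  have upper: "cmod z \<le> root k\<^sub>1 (N\<^sub>1 (C\<^sub>1 ^\<^sub>m k\<^sub>1))"
    unfolding assms(5) by (rule root_norm_le_root_norm_companion_mat_power) (use assms z in auto)
  have "poly (map_poly complex_of_real (monic_reversal p)) (inverse z) = 0"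
    using poly_monic_reversal_inverse[OF z \<open>z \<noteq> 0\<close>]
    by (simp add: map_poly_of_real_monic_reversal)
  then have "cmod (inverse z) \<le> root k\<^sub>2 (N\<^sub>2 (C\<^sub>2 ^\<^sub>m k\<^sub>2))"
    unfolding assms(6)
    by (intro root_norm_le_root_norm_companion_mat_power)
      (use assms lead_coeff_monic_reversal[OF assms(4)] in \<open>simp_all add: degree_monic_reversal\<close>)
  \<comment> \<open>Since \<open>cmod (inverse z) > 0\<close>, the root bounding it is positive too,
    so inversion reverses the inequality and no division by zero is hidden in the inner
    radius.\<close>
  then have "inverse (root k\<^sub>2 (N\<^sub>2 (C\<^sub>2 ^\<^sub>m k\<^sub>2))) \<le> inverse (cmod (inverse z))"
    using \<open>z \<noteq> 0\<close> by (intro le_imp_inverse_le) simp_all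
  then have "1 / root k\<^sub>2 (N\<^sub>2 (C\<^sub>2 ^\<^sub>m k\<^sub>2)) \<le> cmod z"
    by (simp add: norm_divide inverse_eq_divide)
  \<comment> \<open>Splitting \<open>z\<close> into real and imaginary parts matches the set
    comprehension, where the modulus is written out as a square root.\<close>
  with upper have "Complex (Re z) (Im z) \<in> annulus N\<^sub>1 N\<^sub>2 C\<^sub>1 C\<^sub>2 k\<^sub>1 k\<^sub>2"
    unfolding annulus_def cmod_def by blast
  then show "z \<in> annulus N\<^sub>1 N\<^sub>2 C\<^sub>1 C\<^sub>2 k\<^sub>1 k\<^sub>2" by simp
qed

end
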